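(* For every matroid $M$ and every integer $k\ge 1$, the coefficients of $\chi^k_M(t_1,\dots,t_k)$ alternate in sign by total degree; that is, if $c$ and $c'$ are nonzero coefficients in $\chi^k_M$ of monomials of total degrees $d$ and $d'$ respectively, then $c$ and $c'$ have the same sign if $d\equiv d' \pmod 2$ and opposite signs if $d\not\equiv d'\pmod 2$.
   Context: A matroid $M=(\mathcal{A},\mathrm{rk})$ is given by a finite ground set $\mathcal{A}$ and its rank function $\mathrm{rk}$; $\mathrm{rk}(M)=\mathrm{rk}(\mathcal{A})$. For $k\ge 1$ let $\mathcal{C}^k_{\mathcal{A}}=\{(A_1,\dots,A_k)\in(2^{\mathcal{A}})^k \mid A_1\subseteq A_2\subseteq\cdots\subseteq A_k\subseteq\mathcal{A}\}$ (inclusions need not be strict). The $k$th chain characteristic polynomial is $\chi_M^k(t_1,\dots,t_k)=\sum_{(A_i)\in\mathcal{C}^k_{\mathcal{A}}}\prod_{i=1}^k(-1)^{|A_i|}t_i^{\mathrm{rk}(M)-\mathrm{rk}(A_i)}$. The total degree of $t_1^{m_1}\cdots t_k^{m_k}$ is $m_1+\cdots+m_k$. *)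

theory Defs
  imports "HOL-Library.Poly_Mapping" "HOL-Library.FuncSet"
begin

locale matroid =
  fixes E :: "'a set" and rk :: "'a set \<Rightarrow> nat"
  assumes finite_ground: "finite E"
    and rk_le_card: "\<And>A. A \<subseteq> E \<Longrightarrow> rk A \<le> card A"
    and rk_mono: "\<And>A B. A \<subseteq> B \<Longrightarrow> B \<subseteq> E \<Longrightarrow> rk A \<le> rk B"
    and rk_submodular: "\<And>A B. A \<subseteq> E \<Longrightarrow> B \<subseteq> E \<Longrightarrow> rk (A \<union> B) + rk (A \<inter> B) \<le> rk A + rk B"

(* A tuple (A_1, ..., A_k) is a function on {1..k}, undefined elsewhere so that
   distinct functions are distinct tuples. *)
definition chains :: "'a set \<Rightarrow> nat \<Rightarrow> (nat \<Rightarrow> 'a set) set" where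
  "chains E k = {A \<in> {1..k} \<rightarrow>\<^sub>E Pow E. \<forall>i j. 1 \<le> i \<and> i \<le> j \<and> j \<le> k \<longrightarrow> A i \<subseteq> A j}"

(* Integer polynomials in the variables t_i: a monomial is its finitely supported
   exponent function, a polynomial is its finitely supported coefficient function,
   and multiplication is convolution. *)
type_synonym monomial = "nat \<Rightarrow>\<^sub>0 nat"
type_synonym polynomial = "monomial \<Rightarrow>\<^sub>0 int"

definition Var :: "nat \<Rightarrow> polynomial" where
  "Var i = Poly_Mapping.single (Poly_Mapping.single i 1) 1"

definition coefficient :: "polynomial \<Rightarrow> monomial \<Rightarrow> int" where
  "coefficient p m = Poly_Mapping.lookup p m"

definition total_degree :: "monomial \<Rightarrow> nat" where
  "total_degree m = (\<Sum>i\<in>Poly_Mapping.keys m. Poly_Mapping.lookup m i)"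

(* The natural-number subtraction in the exponent does not truncate, by rk_mono. *)
definition chain_char_poly :: "'a set \<Rightarrow> ('a set \<Rightarrow> nat) \<Rightarrow> nat \<Rightarrow> polynomial" where
  "chain_char_poly E rk k =
     (\<Sum>A\<in>chains E k. \<Prod>i=1..k. (-1) ^ card (A i) * Var i ^ (rk E - rk (A i)))"

end

theory Submission
  imports Defs
begin

text \<open>
  Fix the ranks \<open>n\<^sub>1, \<dots>, n\<^sub>k\<close> of the members of the chain, and sum over the largest member \<open>A\<^sub>k\<close>
  alone. The signed count of the sets \<open>A\<close> of rank \<open>n\<close> between \<open>S\<close> and \<open>U\<close> is, up to the factor
  \<open>(-1)\<^bsup>|S|\<^esup>\<close>, a coefficient of the characteristic polynomial of a minor, so deletion and contraction
  give it the sign \<open>(-1)\<^bsup>n - rk S + |S|\<^esup>\<close>. For \<open>S = A\<^sub>k\<^sub>-\<^sub>1\<close> the factor \<open>(-1)\<^bsup>|S|\<^esup>\<close> cancels the one that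
  \<open>A\<^sub>k\<^sub>-\<^sub>1\<close> contributes itself, and what is left is a positive combination, with the sign
  \<open>(-1)\<^bsup>n\<^sub>k + n\<^sub>k\<^sub>-\<^sub>1\<^esup>\<close>, of the signed counts of chains of length \<open>k - 2\<close> below \<open>A\<^sub>k\<^sub>-\<^sub>1\<close>. Hence every nonzero
  coefficient has the sign \<open>(-1)\<^bsup>n\<^sub>1 + \<dots> + n\<^sub>k\<^esup>\<close>.
\<close>

section \<open>Signs and sums over intervals of sets\<close>

lemma minus_one_power_cong:
  assumes "even a = even b"
  shows "(-1 :: int) ^ a = (-1) ^ b"
  using assms by (metis neg_one_even_power neg_one_odd_power)

lemma sum_interval_split:
  assumes "finite U" "e \<in> U" "e \<notin> S" "S \<subseteq> U"
  shows "(\<Sum>A | S \<subseteq> A \<and> A \<subseteq> U. f A) =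
    (\<Sum>A | S \<subseteq> A \<and> A \<subseteq> U - {e}. f A) + (\<Sum>A | insert e S \<subseteq> A \<and> A \<subseteq> U. f A)"
proof -
  have "{A. S \<subseteq> A \<and> A \<subseteq> U} = {A. S \<subseteq> A \<and> A \<subseteq> U - {e}} \<union> {A. insert e S \<subseteq> A \<and> A \<subseteq> U}"
    using assms by blast
  moreover have "finite {A. S \<subseteq> A \<and> A \<subseteq> U - {e}}" "finite {A. insert e S \<subseteq> A \<and> A \<subseteq> U}"
    by (rule finite_subset[of _ "Pow U"]; use assms in auto)+
  ultimately show ?thesis
    by (auto intro!: sum.union_disjoint simp: disjoint_iff)
qed

text \<open>With this reindexing both halves of the split range over the same interval, so the terms
  for \<open>A\<close> and \<open>insert e A\<close> can be compared in pairs.\<close>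

lemma sum_interval_insert:
  assumes "e \<in> U" "e \<notin> S"
  shows "(\<Sum>A | insert e S \<subseteq> A \<and> A \<subseteq> U. f A) =
    (\<Sum>A | S \<subseteq> A \<and> A \<subseteq> U - {e}. f (insert e A))"
  by (rule sum.reindex_bij_witness[of _ "insert e" "\<lambda>A. A - {e}"])
     (use assms in \<open>auto simp: insert_absorb\<close>)

section \<open>Sets of one rank in an interval of a matroid\<close>

lemma (in matroid) rk_insert_eq_mono:
  assumes "rk (insert e S) = rk S" "S \<subseteq> A" "A \<subseteq> E" "e \<in> E"
  shows "rk (insert e A) = rk A"
proof (cases "e \<in> A")
  case False
  have "rk (insert e S \<union> A) + rk (insert e S \<inter> A) \<le> rk (insert e S) + rk A"
    using assms by (intro rk_submodular) auto
  moreover have "insert e S \<union> A = insert e A" "insert e S \<inter> A = S"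
    using assms False by auto
  moreover have "rk A \<le> rk (insert e A)"
    using assms by (intro rk_mono) auto
  ultimately show ?thesis
    using assms(1) by simp
qed (simp add: insert_absorb)

lemma (in matroid) rk_insert_le:
  assumes "S \<subseteq> E" "e \<in> E"
  shows "rk (insert e S) \<le> Suc (rk S)"
proof -
  have "rk (S \<union> {e}) + rk (S \<inter> {e}) \<le> rk S + rk {e}"
    using assms by (intro rk_submodular) auto
  moreover have "rk {e} \<le> card {e}"
    using assms by (intro rk_le_card) auto
  ultimately show ?thesis by simp
qed

definition rank_sign :: "('a set \<Rightarrow> nat) \<Rightarrow> nat \<Rightarrow> 'a set \<Rightarrow> int" where
  "rank_sign rk n A = (if rk A = n then (-1) ^ card A else 0)"

text \<open>Induction on the size of \<open>U - S\<close>, choosing \<open>e\<close> in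
  \<open>U - S\<close>. If \<open>e\<close> is a loop after contracting \<open>S\<close>, the sum
  vanishes; otherwise deletion and contraction of \<open>e\<close> leave two smaller intervals with
  the same sign.\<close>

lemma (in matroid) interval_rank_sign_sum:
  assumes "S \<subseteq> U" "U \<subseteq> E"
  shows "0 \<le> (-1) ^ (n + rk S + card S) * (\<Sum>A | S \<subseteq> A \<and> A \<subseteq> U. rank_sign rk n A)"
  using assms
proof (induction "card (U - S)" arbitrary: S U rule: less_induct)
  case less
  have fin: "finite U" "finite S"
    using less.prems finite_ground by (meson finite_subset)+
  show ?case
  proof (cases "U = S")
    case True
    then have "{A. S \<subseteq> A \<and> A \<subseteq> U} = {S}" by blast
    then show ?thesis
      by (simp add: rank_sign_def flip: power_add)
  next
    case False
    then obtain e where e: "e \<in> U" "e \<notin> S"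
      using less.prems by blast
    show ?thesis
    proof (cases "rk (insert e S) = rk S")
      \<comment> \<open>By submodularity \<open>e\<close> is redundant over every \<open>A\<close>
        above \<open>S\<close>, so adding it keeps the rank and flips the sign: the terms cancel in
        pairs.\<close>
      case True
      have "rank_sign rk n (insert e A) = - rank_sign rk n A" if "S \<subseteq> A" "A \<subseteq> U - {e}" for A
      proof -
        have "finite A" "e \<notin> A" using that fin by (auto intro: finite_subset)
        moreover have "rk (insert e A) = rk A"
          using that e less.prems by (intro rk_insert_eq_mono[OF True]) auto
        ultimately show ?thesis by (simp add: rank_sign_def)
      qed
      then have "(\<Sum>A | S \<subseteq> A \<and> A \<subseteq> U. rank_sign rk n A) = 0"
        unfolding sum_interval_split[OF fin(1) e less.prems(1)] sum_interval_insert[OF e]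
        by (simp add: sum_negf)
      then show ?thesis by simp
    next
      case False
      have "rk S \<le> rk (insert e S)"
        using e less.prems by (intro rk_mono) auto
      moreover have "rk (insert e S) \<le> Suc (rk S)"
        using e less.prems by (intro rk_insert_le) auto
      ultimately have "rk (insert e S) = Suc (rk S)"
        using False by simp
      \<comment> \<open>Rank and cardinality of the lower end both grow by one, so the parity of the
        exponent is unchanged.\<close>
      then have "n + rk (insert e S) + card (insert e S) = Suc (Suc (n + rk S + card S))"
        using e fin by simp
      then have sgn_eq: "(-1 :: int) ^ (n + rk (insert e S) + card (insert e S)) = (-1) ^ (n + rk S + card S)"
        by (simp only: power_Suc mult_minus1 minus_minus)
      have "card (U - {e} - S) < card (U - S)" "card (U - insert e S) < card (U - S)"
        by (rule psubset_card_mono; use e fin in blast)+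
      then have "0 \<le> (-1) ^ (n + rk S + card S) * (\<Sum>A | S \<subseteq> A \<and> A \<subseteq> U - {e}. rank_sign rk n A)"
        and "0 \<le> (-1) ^ (n + rk (insert e S) + card (insert e S)) *
          (\<Sum>A | insert e S \<subseteq> A \<and> A \<subseteq> U. rank_sign rk n A)"
        by (intro less.hyps; use e less.prems in blast)+
      then show ?thesis
        using e fin less.prems
        unfolding sgn_eq by (simp add: sum_interval_split[of U e S] distrib_left)
    qed
  qed
qed

section \<open>Signed counts of chains with prescribed ranks\<close>

lemma chains_0: "chains U 0 = {\<lambda>_. undefined}"
  by (auto simp: chains_def)

lemma finite_chains: "finite U \<Longrightarrow> finite (chains U k)"
  unfolding chains_def by (auto intro!: finite_PiE)

lemma sum_chains_Suc:
  assumes "finite U"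
  shows "(\<Sum>A\<in>chains U (Suc k). f A) = (\<Sum>T\<in>Pow U. \<Sum>B\<in>chains T k. f (B(Suc k := T)))"
proof -
  have "(\<Sum>T\<in>Pow U. \<Sum>B\<in>chains T k. f (B(Suc k := T))) =
      (\<Sum>(T, B)\<in>Sigma (Pow U) (\<lambda>T. chains T k). f (B(Suc k := T)))"
    using assms by (intro sum.Sigma) (auto intro: finite_chains finite_subset)
  also have "\<dots> = (\<Sum>A\<in>chains U (Suc k). f A)"
  \<comment> \<open>Dropping the last set resets index \<open>Suc k\<close> to
    \<open>undefined\<close>, the value that tuples of length \<open>k\<close> have there.\<close>
  proof (rule sum.reindex_bij_witness
      [of _ "\<lambda>A. (A (Suc k), A(Suc k := undefined))" "\<lambda>(T, B). B(Suc k := T)"])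
    fix p assume "p \<in> Sigma (Pow U) (\<lambda>T. chains T k)"
    then obtain T B where p: "p = (T, B)" and "T \<subseteq> U" and B: "B \<in> chains T k" by auto
    have "B (Suc k) = undefined"
      using B by (auto simp: chains_def PiE_def extensional_def)
    then show "(((\<lambda>(T, B). B(Suc k := T)) p) (Suc k),
        ((\<lambda>(T, B). B(Suc k := T)) p)(Suc k := undefined)) = p"
      by (simp add: p fun_upd_idem)
    have B_subset: "B i \<subseteq> T" if "i \<in> {1..k}" for i
      using B that by (auto simp: chains_def PiE_def Pi_def)
    show "(\<lambda>(T, B). B(Suc k := T)) p \<in> chains U (Suc k)"
      unfolding p prod.case chains_def
    proof (intro CollectI conjI PiE_I allI impI)
      fix i j assume "1 \<le> i \<and> i \<le> j \<and> j \<le> Suc k"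
      then consider "j = Suc k" "i = Suc k" | "j = Suc k" "i \<in> {1..k}" | "1 \<le> i" "i \<le> j" "j \<le> k"
        by fastforce
      then show "(B(Suc k := T)) i \<subseteq> (B(Suc k := T)) j"
        using B B_subset[of i] by cases (auto simp: chains_def)
    next
      fix i assume "i \<in> {1..Suc k}"
      then show "(B(Suc k := T)) i \<in> Pow U"
        using \<open>T \<subseteq> U\<close> B_subset[of i] by (cases "i = Suc k") auto
    next
      fix i assume "i \<notin> {1..Suc k}"
      then show "(B(Suc k := T)) i = undefined"
        using B by (auto simp: chains_def PiE_def extensional_def)
    qed
  next
    fix A assume A: "A \<in> chains U (Suc k)"
    have "A i \<subseteq> A (Suc k)" if "i \<in> {1..k}" for i
      using A that by (auto simp: chains_def)
    moreover have "A (Suc k) \<subseteq> U"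
      using A by (auto simp: chains_def PiE_def Pi_def)
    moreover have "A i = undefined" if "i \<notin> {1..Suc k}" for i
      using A that by (auto simp: chains_def PiE_def extensional_def)
    moreover have "A i \<subseteq> A j" if "1 \<le> i" "i \<le> j" "j \<le> k" for i j
      using A that by (auto simp: chains_def)
    ultimately show "(A (Suc k), A(Suc k := undefined)) \<in> Sigma (Pow U) (\<lambda>T. chains T k)"
      unfolding chains_def by (intro SigmaI CollectI conjI PiE_I allI impI) auto
  qed auto
  finally show ?thesis by simp
qed

text \<open>For \<open>U = E\<close> this becomes a coefficient of the chain polynomial.
  \<open>U\<close> is a parameter because removing the largest set of a chain makes that set the new
  upper bound.\<close>

definition chain_rank_sum :: "('a set \<Rightarrow> nat) \<Rightarrow> (nat \<Rightarrow> nat) \<Rightarrow> 'a set \<Rightarrow> nat \<Rightarrow> int" where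
  "chain_rank_sum rk n U k = (\<Sum>A\<in>chains U k. \<Prod>i=1..k. rank_sign rk (n i) (A i))"

lemma chain_rank_sum_0: "chain_rank_sum rk n U 0 = 1"
  by (simp add: chain_rank_sum_def chains_0)

lemma chain_rank_sum_Suc:
  assumes "finite U"
  shows "chain_rank_sum rk n U (Suc k) =
    (\<Sum>T\<in>Pow U. rank_sign rk (n (Suc k)) T * chain_rank_sum rk n T k)"
proof -
  have "(\<Prod>i=1..Suc k. rank_sign rk (n i) ((B(Suc k := T)) i)) =
      rank_sign rk (n (Suc k)) T * (\<Prod>i=1..k. rank_sign rk (n i) (B i))" for B and T :: "'a set"
  proof -
    have "(\<Prod>i=1..k. rank_sign rk (n i) ((B(Suc k := T)) i)) = (\<Prod>i=1..k. rank_sign rk (n i) (B i))"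
      by (intro prod.cong) auto
    then show ?thesis by (simp add: mult.commute)
  qed
  then show ?thesis
    by (simp only: chain_rank_sum_def sum_chains_Suc[OF assms] sum_distrib_left)
qed

text \<open>Removing one set leaves a factor \<open>(-1) ^ card T\<close> whose sign varies with
  \<open>T\<close>. Removing two and exchanging the sums lets the largest set range over an interval
  above the second largest, where the sign is known.\<close>

lemma chain_rank_sum_Suc_Suc:
  assumes "finite U"
  shows "chain_rank_sum rk n U (Suc (Suc k)) =
    (\<Sum>F\<in>Pow U. rank_sign rk (n (Suc k)) F * chain_rank_sum rk n F k *
      (\<Sum>A | F \<subseteq> A \<and> A \<subseteq> U. rank_sign rk (n (Suc (Suc k))) A))"
proof -
  \<comment> \<open>The inner index set is written as a restriction of \<open>Pow U\<close>, as
    \<open>sum.swap_restrict\<close> requires.\<close>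
  have "chain_rank_sum rk n U (Suc (Suc k)) =
      (\<Sum>T\<in>Pow U. \<Sum>F | F \<in> Pow U \<and> F \<subseteq> T.
        rank_sign rk (n (Suc (Suc k))) T * (rank_sign rk (n (Suc k)) F * chain_rank_sum rk n F k))"
    unfolding chain_rank_sum_Suc[OF assms, of rk n "Suc k"]
  proof (intro sum.cong refl)
    fix T assume "T \<in> Pow U"
    then have "finite T" "{F. F \<in> Pow U \<and> F \<subseteq> T} = Pow T"
      using assms by (auto intro: finite_subset)
    then show "rank_sign rk (n (Suc (Suc k))) T * chain_rank_sum rk n T (Suc k) =
      (\<Sum>F | F \<in> Pow U \<and> F \<subseteq> T.
        rank_sign rk (n (Suc (Suc k))) T * (rank_sign rk (n (Suc k)) F * chain_rank_sum rk n F k))"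
      by (simp only: chain_rank_sum_Suc sum_distrib_left)
  qed
  also have "\<dots> = (\<Sum>F\<in>Pow U. \<Sum>T | T \<in> Pow U \<and> F \<subseteq> T.
        rank_sign rk (n (Suc (Suc k))) T * (rank_sign rk (n (Suc k)) F * chain_rank_sum rk n F k))"
    using assms by (intro sum.swap_restrict) auto
  also have "\<dots> = (\<Sum>F\<in>Pow U. rank_sign rk (n (Suc k)) F * chain_rank_sum rk n F k *
      (\<Sum>A | F \<subseteq> A \<and> A \<subseteq> U. rank_sign rk (n (Suc (Suc k))) A))"
    by (simp add: sum_distrib_left mult_ac conj_commute)
  finally show ?thesis .
qed

text \<open>The induction goes in steps of two, with \<open>U\<close> arbitrary since the hypothesis
  is applied to the second largest set \<open>F\<close>. Length one is the interval sum from the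
  empty set.\<close>

lemma (in matroid) chain_rank_sum_sign:
  assumes "U \<subseteq> E"
  shows "0 \<le> (-1) ^ (\<Sum>i=1..k. n i) * chain_rank_sum rk n U k"
  using assms
proof (induction k arbitrary: U rule: induct_nat_012)
  case 0
  then show ?case by (simp add: chain_rank_sum_0)
next
  case 1
  have "finite U" using 1 finite_ground by (meson finite_subset)
  moreover have "rk {} = 0" using rk_le_card[of "{}"] by simp
  moreover have "{A. A \<subseteq> U} = Pow U" by auto
  ultimately show ?case
    using interval_rank_sign_sum[of "{}" U "n 1"] 1
    by (simp add: chain_rank_sum_Suc chain_rank_sum_0)
next
  case (ge2 k)
  have fin: "finite U" using ge2.prems finite_ground by (meson finite_subset)
  let ?h = "\<lambda>F. \<Sum>A | F \<subseteq> A \<and> A \<subseteq> U. rank_sign rk (n (Suc (Suc k))) A"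
  have "0 \<le> (-1) ^ (\<Sum>i=1..Suc (Suc k). n i) *
      (rank_sign rk (n (Suc k)) F * chain_rank_sum rk n F k * ?h F)" if "F \<subseteq> U" for F
  proof (cases "rk F = n (Suc k)")
    case True
    \<comment> \<open>Here \<open>rk F\<close> is the missing summand \<open>n (Suc k)\<close> of
      the exponent, and \<open>(-1) ^ card F\<close> is the value of \<open>rank_sign\<close> at
      \<open>F\<close>.\<close>
    have "0 \<le> ((-1) ^ (\<Sum>i=1..k. n i) * chain_rank_sum rk n F k) *
        ((-1) ^ (n (Suc (Suc k)) + rk F + card F) * ?h F)"
      using that ge2.prems by (intro mult_nonneg_nonneg ge2.IH(1) interval_rank_sign_sum) auto
    then show ?thesis
      using True by (simp add: rank_sign_def power_add mult_ac)
  qed (simp add: rank_sign_def)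
  then show ?case
    unfolding chain_rank_sum_Suc_Suc[OF fin] sum_distrib_left[of _ _ "Pow U"]
    by (intro sum_nonneg) blast
qed

section \<open>Monomials and coefficients\<close>

lemma Var_power: "Var i ^ e = Poly_Mapping.single (Poly_Mapping.single i e) 1"
  by (induction e) (simp_all add: Var_def mult_single flip: single_one single_add)

lemma prod_signed_Var_power:
  assumes "finite I"
  shows "(\<Prod>i\<in>I. (-1) ^ c i * Var i ^ e i) =
    Poly_Mapping.single (\<Sum>i\<in>I. Poly_Mapping.single i (e i)) (\<Prod>i\<in>I. (-1) ^ c i)"
  using assms
proof induction
  case empty
  then show ?case by simp
next
  case (insert x I)
  \<comment> \<open>The sign becomes a constant monomial, so that \<open>mult_single\<close>
    applies.\<close>
  have "(-1) ^ c x = (Poly_Mapping.single 0 ((-1) ^ c x) :: polynomial)"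
    by (cases "even (c x)") (simp_all add: single_uminus)
  then show ?case
    using insert by (simp add: Var_power mult_single)
qed

lemma lookup_sum_single:
  assumes "finite I"
  shows "Poly_Mapping.lookup (\<Sum>i\<in>I. Poly_Mapping.single i (e i :: nat)) j = (if j \<in> I then e j else 0)"
  using assms by (simp add: lookup_sum lookup_single when_def)

lemma coefficient_chain_char_poly:
  "coefficient (chain_char_poly E rk k) m =
    (\<Sum>A\<in>chains E k. if (\<Sum>i=1..k. Poly_Mapping.single i (rk E - rk (A i))) = m
      then \<Prod>i=1..k. (-1) ^ card (A i) else 0)"
  by (simp add: coefficient_def chain_char_poly_def prod_signed_Var_power lookup_sum lookup_single when_def
      del: One_nat_def)

lemma total_degree_eq:
  assumes "Poly_Mapping.keys m \<subseteq> {1..k}"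
  shows "total_degree m = (\<Sum>i=1..k. Poly_Mapping.lookup m i)"
  unfolding total_degree_def using assms
  by (intro sum.mono_neutral_left) (auto simp: in_keys_iff)

text \<open>An exponent \<open>e\<close> of a variable prescribes the rank \<open>rk E - e\<close>,
  so the prescribed ranks add up to \<open>k * rk E - total_degree m\<close>.\<close>

lemma (in matroid) coefficient_chain_char_poly_sign:
  assumes "coefficient (chain_char_poly E rk k) m \<noteq> 0"
  shows "0 < (-1) ^ (k * rk E + total_degree m) * coefficient (chain_char_poly E rk k) m"
proof -
  let ?M = "\<lambda>A. \<Sum>i=1..k. Poly_Mapping.single i (rk E - rk (A i))"
  let ?n = "\<lambda>i. rk E - Poly_Mapping.lookup m i"
  \<comment> \<open>A nonzero coefficient needs a chain that yields \<open>m\<close>; hence the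
    exponents of \<open>m\<close> are at most \<open>rk E\<close>, and the subtraction in
    \<open>?n\<close> does not truncate.\<close>
  obtain C where "?M C = m"
    using assms unfolding coefficient_chain_char_poly
    by (auto elim!: sum.not_neutral_contains_not_neutral split: if_splits)
  then have lookup_m: "Poly_Mapping.lookup m i = (if i \<in> {1..k} then rk E - rk (C i) else 0)" for i
    using lookup_sum_single[of "{1..k}" "\<lambda>i. rk E - rk (C i)" i] by simp
  then have keys: "Poly_Mapping.keys m \<subseteq> {1..k}" and le: "\<And>i. Poly_Mapping.lookup m i \<le> rk E"
    by (auto simp: in_keys_iff split: if_splits)
  have "(if ?M A = m then \<Prod>i=1..k. (-1) ^ card (A i) else 0) =
      (\<Prod>i=1..k. rank_sign rk (?n i) (A i))" if A: "A \<in> chains E k" for A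
  proof -
    have "rk (A i) \<le> rk E" if "i \<in> {1..k}" for i
      using A that by (intro rk_mono) (auto simp: chains_def PiE_def Pi_def)
    then have eq: "rk E - rk (A i) = Poly_Mapping.lookup m i \<longleftrightarrow> rk (A i) = ?n i" if "i \<in> {1..k}" for i
      using le[of i] that by fastforce
    have "?M A = m \<longleftrightarrow> (\<forall>i\<in>{1..k}. rk E - rk (A i) = Poly_Mapping.lookup m i)"
      using keys by (auto simp: poly_mapping_eq_iff fun_eq_iff lookup_sum_single in_keys_iff lookup_m)
    then have iff: "?M A = m \<longleftrightarrow> (\<forall>i\<in>{1..k}. rk (A i) = ?n i)"
      using eq by simp
    show ?thesis
    proof (cases "?M A = m")
      case True
      then show ?thesis using iff by (simp add: rank_sign_def)
    next
      case False
      then show ?thesis using iff by (auto simp: rank_sign_def)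
    qed
  qed
  then have "coefficient (chain_char_poly E rk k) m = chain_rank_sum rk ?n E k"
    by (simp add: coefficient_chain_char_poly chain_rank_sum_def)
  moreover have "(-1 :: int) ^ (\<Sum>i=1..k. ?n i) = (-1) ^ (k * rk E + total_degree m)"
  proof (rule minus_one_power_cong)
    have "(\<Sum>i=1..k. ?n i) + total_degree m = k * rk E"
      using le by (simp add: total_degree_eq[OF keys] flip: sum.distrib)
    then show "even (\<Sum>i=1..k. ?n i) = even (k * rk E + total_degree m)"
      by presburger
  qed
  ultimately have "0 \<le> (-1) ^ (k * rk E + total_degree m) * coefficient (chain_char_poly E rk k) m"
    using chain_rank_sum_sign[of E ?n k] by simp
  moreover have "(-1) ^ (k * rk E + total_degree m) * coefficient (chain_char_poly E rk k) m \<noteq> 0"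
    using assms by simp
  ultimately show ?thesis
    by linarith
qed

theorem corollary1p8:
  fixes E :: "'a set" and rk :: "'a set \<Rightarrow> nat" and k :: nat
    and m m' :: monomial
  assumes "matroid E rk"
    and "k \<ge> 1"
    and "coefficient (chain_char_poly E rk k) m \<noteq> 0"
    and "coefficient (chain_char_poly E rk k) m' \<noteq> 0"
  shows "(total_degree m mod 2 = total_degree m' mod 2 \<longrightarrow>
           sgn (coefficient (chain_char_poly E rk k) m)
             = sgn (coefficient (chain_char_poly E rk k) m')) \<and>
         (total_degree m mod 2 \<noteq> total_degree m' mod 2 \<longrightarrow>
           sgn (coefficient (chain_char_poly E rk k) m)
             = - sgn (coefficient (chain_char_poly E rk k) m'))"
proof -
  interpret matroid E rk by fact
  \<comment> \<open>The offset \<open>k * rk E\<close> is common to all monomials, so only the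
    parity of the total degree distinguishes the signs.\<close>
  have sgn_eq: "sgn (coefficient (chain_char_poly E rk k) p) = (-1) ^ (k * rk E + total_degree p)"
    if "coefficient (chain_char_poly E rk k) p \<noteq> 0" for p
    using coefficient_chain_char_poly_sign[OF that]
    by (cases "even (k * rk E + total_degree p)") simp_all
  show ?thesis
    unfolding sgn_eq[OF assms(3)] sgn_eq[OF assms(4)]
    by (auto simp: power_add minus_one_power_iff even_iff_mod_2_eq_zero)
qed

end
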